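(* Suppose (OPT) has a feasible solution, and let $(b^*,\gamma^* )$, with set of bid values $\mathcal P$ and components $(\mathcal C_c(p^* ),\mathcal C_t(p^* ))$, $p^*\in\mathcal P$, be the allocation obtained by the algorithm described in the context. For $p^*\in\mathcal P$ let $D_{p^*}(b)=\sum_{j\in\mathcal C_t(p^* )}D_j(b)$, $b\ge0$, and $I_{p^*}=\sum_{i\in\mathcal C_c(p^* )}I_i$. If the supply curves $D_j$, $j\in\mathcal T$, are continuous functions, then $(b^*,\gamma^* )$ is an optimal solution of (OPT), with cost $$\sum_{p^*\in\mathcal P}\Big[I_{p^*}p^*-\int_0^{p^*}D_{p^*}(b)\,db\Big].$$
   Context: Model: $\mathcal N=\{1,\dots,N_c\}$ is a finite set of campaigns and $\mathcal T=\{1,\dots,N_r\}$ a finite set of targeting groups. Campaign $i$ requires $I_i\ge 0$ impressions and may bid only on the targeting groups in a given set $\mathcal A_i\subseteq\mathcal T$; for $j\in\mathcal T$ put $\mathcal B_j=\{i\in\mathcal N: j\in\mathcal A_i\}$, and every $\mathcal B_j$ is nonempty. Targeting group $j$ has a supply curve $D_j:[0,\infty)\to[0,\infty)$, non-decreasing and right-continuous. An allocation $(b,\gamma)$ consists of bid values $b_{i,j}\ge 0$ and fractions $\gamma_{i,j}\ge 0$ for all pairs with $j\in\mathcal A_i$; $\gamma_{i,j}=0$ for $j\notin\mathcal A_i$. Problem (OPT): minimize over allocations $$\sum_{i=1}^{N_c}\sum_{j=1}^{N_r}\gamma_{i,j}\Big(D_j(b_{i,j})b_{i,j}-\int_0^{b_{i,j}}D_j(x)\,dx\Big)$$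 subject to $\sum_{j\in\mathcal A_i}\gamma_{i,j}D_j(b_{i,j})\ge I_i$ for all $i\in\mathcal N$, $\sum_{i\in\mathcal B_j}\gamma_{i,j}\le 1$ for all $j\in\mathcal T$, $b_{i,j}\ge0$, $\gamma_{i,j}\ge 0$. Algorithm. For $\mathcal C_c\subseteq\mathcal N$, $\mathcal C_t\subseteq\mathcal T$: PRICE$(\mathcal C_c,\mathcal C_t)$ is the unique $p\ge0$ with $\sum_{j\in\mathcal C_t}D_j(p)\ge\sum_{i\in\mathcal C_c}I_i$ and $\sum_{j\in\mathcal C_t}D_j(b)<\sum_{i\in\mathcal C_c}I_i$ for all $0\le b<p$. ALLOC$(\mathcal C_c,\mathcal C_t,p)$ is the convex problem of minimizing $\sum_{i\in\mathcal C_c}\big(I_i-\sum_{j\in\mathcal A_i\cap\mathcal C_t}t_{i,j}D_j(p)\big)^2$ over $t_{i,j}\ge0$ ($i\in\mathcal C_c$, $j\in\mathcal A_i\cap\mathcal C_t$; $t_{i,j}=0$ otherwise) subject to $\sum_{i\in\mathcal B_j\cap\mathcal C_c}t_{i,j}\le1$ for $j\in\mathcal C_t$. The recursive procedure REC$(\mathcal C_c,\mathcal C_t)$: compute $p=$ PRICE$(\mathcal C_c,\mathcal C_t)$ and an (arbitrary) optimal solution $t^*$ of ALLOC$(\mathcal C_c,\mathcal C_t,p)$. If its optimal value is $0$, stop and output the single component $(\mathcal C_c,\mathcal C_t)$ with bid value $p$ and allocation $t=t^*$. Otherwise (SPLIT) set $\mathcal C_c^{(1)}=\{i\in\mathcal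 C_c: I_i\ne\sum_{j\in\mathcal A_i\cap\mathcal C_t}t^*_{i,j}D_j(p)\}$, $\mathcal C_t^{(1)}=\mathcal C_t\cap\bigcup_{i\in\mathcal C_c^{(1)}}\mathcal A_i$, $\mathcal C_c^{(2)}=\mathcal C_c\setminus\mathcal C_c^{(1)}$, $\mathcal C_t^{(2)}=\mathcal C_t\setminus\mathcal C_t^{(1)}$, and output all components output by REC$(\mathcal C_c^{(1)},\mathcal C_t^{(1)})$ and REC$(\mathcal C_c^{(2)},\mathcal C_t^{(2)})$. Run REC$(\mathcal N,\mathcal T)$. Let $\mathcal P$ be the set of bid values of the output components; the components are indexed by their bid values $p^*\in\mathcal P$ and written $(\mathcal C_c(p^* ),\mathcal C_t(p^* ))$. The allocation $(b^*,\gamma^* )$ obtained by the algorithm is: for $i\in\mathcal C_c(p^* )$, $b^*_{i,j}=p^*$ and $\gamma^*_{i,j}=t_{i,j}$ if $j\in\mathcal C_t(p^* )$ (with $t$ the allocation of that component), and $\gamma^*_{i,j}=0$ if $j\notin\mathcal C_t(p^* )$. *)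

theory Defs
  imports "HOL-Analysis.Analysis"
begin

text \<open>
  Campaigns are \<open>{1..Nc}\<close>, targeting groups are \<open>{1..Nr}\<close>. \<open>I i\<close> is the number of impressions
  required by campaign \<open>i\<close>, \<open>A i\<close> its set of admissible targeting groups, and \<open>D j\<close> the supply
  curve of group \<open>j\<close>, of which only the values on \<open>{0..}\<close> matter.
\<close>

definition bidders :: "nat \<Rightarrow> (nat \<Rightarrow> nat set) \<Rightarrow> nat \<Rightarrow> nat set" where
  "bidders Nc A j = {i \<in> {1..Nc}. j \<in> A i}"

subsection \<open>The problem (OPT)\<close>

text \<open>
  Bids \<open>b i j\<close> with \<open>j \<notin> A i\<close> are not part of an allocation; they are left unconstrained and do not
  influence the cost, because \<open>\<gamma> i j = 0\<close> there.
\<close>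

definition opt_feasible ::
  "nat \<Rightarrow> nat \<Rightarrow> (nat \<Rightarrow> real) \<Rightarrow> (nat \<Rightarrow> nat set) \<Rightarrow> (nat \<Rightarrow> real \<Rightarrow> real)
    \<Rightarrow> (nat \<Rightarrow> nat \<Rightarrow> real) \<times> (nat \<Rightarrow> nat \<Rightarrow> real) \<Rightarrow> bool" where
  "opt_feasible Nc Nr I A D = (\<lambda>(b, \<gamma>).
     (\<forall>i\<in>{1..Nc}. \<forall>j\<in>A i. 0 \<le> b i j \<and> 0 \<le> \<gamma> i j) \<and>
     (\<forall>i\<in>{1..Nc}. \<forall>j\<in>{1..Nr} - A i. \<gamma> i j = 0) \<and>
     (\<forall>i\<in>{1..Nc}. I i \<le> (\<Sum>j\<in>A i. \<gamma> i j * D j (b i j))) \<and>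
     (\<forall>j\<in>{1..Nr}. (\<Sum>i\<in>bidders Nc A j. \<gamma> i j) \<le> 1))"

definition opt_cost ::
  "nat \<Rightarrow> nat \<Rightarrow> (nat \<Rightarrow> real \<Rightarrow> real)
    \<Rightarrow> (nat \<Rightarrow> nat \<Rightarrow> real) \<times> (nat \<Rightarrow> nat \<Rightarrow> real) \<Rightarrow> real" where
  "opt_cost Nc Nr D = (\<lambda>(b, \<gamma>).
     \<Sum>i = 1..Nc. \<Sum>j = 1..Nr. \<gamma> i j * (D j (b i j) * b i j - integral {0..b i j} (D j)))"

subsection \<open>The algorithm\<close>

definition is_price ::
  "(nat \<Rightarrow> real) \<Rightarrow> (nat \<Rightarrow> real \<Rightarrow> real) \<Rightarrow> nat set \<Rightarrow> nat set \<Rightarrow> real \<Rightarrow> bool" where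
  "is_price I D Cc Ct p \<longleftrightarrow>
     0 \<le> p \<and> (\<Sum>i\<in>Cc. I i) \<le> (\<Sum>j\<in>Ct. D j p) \<and>
     (\<forall>b. 0 \<le> b \<and> b < p \<longrightarrow> (\<Sum>j\<in>Ct. D j b) < (\<Sum>i\<in>Cc. I i))"

definition alloc_feasible ::
  "nat \<Rightarrow> (nat \<Rightarrow> nat set) \<Rightarrow> nat set \<Rightarrow> nat set \<Rightarrow> (nat \<Rightarrow> nat \<Rightarrow> real) \<Rightarrow> bool" where
  "alloc_feasible Nc A Cc Ct t \<longleftrightarrow>
     (\<forall>i j. if i \<in> Cc \<and> j \<in> A i \<inter> Ct then 0 \<le> t i j else t i j = 0) \<and>
     (\<forall>j\<in>Ct. (\<Sum>i\<in>bidders Nc A j \<inter> Cc. t i j) \<le> 1)"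

definition delivered ::
  "(nat \<Rightarrow> nat set) \<Rightarrow> (nat \<Rightarrow> real \<Rightarrow> real) \<Rightarrow> nat set \<Rightarrow> real
    \<Rightarrow> (nat \<Rightarrow> nat \<Rightarrow> real) \<Rightarrow> nat \<Rightarrow> real" where
  "delivered A D Ct p t i = (\<Sum>j\<in>A i \<inter> Ct. t i j * D j p)"

definition alloc_cost ::
  "(nat \<Rightarrow> real) \<Rightarrow> (nat \<Rightarrow> nat set) \<Rightarrow> (nat \<Rightarrow> real \<Rightarrow> real) \<Rightarrow> nat set \<Rightarrow> nat set \<Rightarrow> real
    \<Rightarrow> (nat \<Rightarrow> nat \<Rightarrow> real) \<Rightarrow> real" where
  "alloc_cost I A D Cc Ct p t = (\<Sum>i\<in>Cc. (I i - delivered A D Ct p t i)\<^sup>2)"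

datatype component =
  Component (campaigns: "nat set") (targets: "nat set") (bid: real) (fraction: "nat \<Rightarrow> nat \<Rightarrow> real")

text \<open>
  \<open>rec_run Nc I A D Cc Ct out\<close>: some terminating run of the procedure on \<open>(Cc, Ct)\<close> outputs the set
  \<open>out\<close> of components. It is a relation because every call may pick any optimal solution of ALLOC.
\<close>

inductive rec_run ::
  "nat \<Rightarrow> (nat \<Rightarrow> real) \<Rightarrow> (nat \<Rightarrow> nat set) \<Rightarrow> (nat \<Rightarrow> real \<Rightarrow> real)
    \<Rightarrow> nat set \<Rightarrow> nat set \<Rightarrow> component set \<Rightarrow> bool"
  for Nc I A D where
  stop:
    "\<lbrakk> is_price I D Cc Ct p;
       is_arg_min (alloc_cost I A D Cc Ct p) (alloc_feasible Nc A Cc Ct) t;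
       alloc_cost I A D Cc Ct p t = 0 \<rbrakk>
     \<Longrightarrow> rec_run Nc I A D Cc Ct {Component Cc Ct p t}"
| split:
    "\<lbrakk> is_price I D Cc Ct p;
       is_arg_min (alloc_cost I A D Cc Ct p) (alloc_feasible Nc A Cc Ct) t;
       alloc_cost I A D Cc Ct p t \<noteq> 0;
       Cc1 = {i \<in> Cc. I i \<noteq> delivered A D Ct p t i};
       Ct1 = Ct \<inter> (\<Union>i\<in>Cc1. A i);
       rec_run Nc I A D Cc1 Ct1 out1;
       rec_run Nc I A D (Cc - Cc1) (Ct - Ct1) out2 \<rbrakk>
     \<Longrightarrow> rec_run Nc I A D Cc Ct (out1 \<union> out2)"

definition bid_values :: "component set \<Rightarrow> real set" where
  "bid_values out = bid ` out"

definition component_at :: "component set \<Rightarrow> real \<Rightarrow> component" where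
  "component_at out p = (THE c. c \<in> out \<and> bid c = p)"

definition component_of :: "component set \<Rightarrow> nat \<Rightarrow> component" where
  "component_of out i = (THE c. c \<in> out \<and> i \<in> campaigns c)"

definition alg_bid :: "component set \<Rightarrow> nat \<Rightarrow> nat \<Rightarrow> real" where
  "alg_bid out i j = bid (component_of out i)"

definition alg_fraction :: "component set \<Rightarrow> nat \<Rightarrow> nat \<Rightarrow> real" where
  "alg_fraction out i j =
     (if j \<in> targets (component_of out i) then fraction (component_of out i) i j else 0)"

end

theory Submission
  imports Defs
begin

text \<open>
  When a call at price \<open>p\<close> splits, the first-order condition of ALLOC shows that every set \<open>S\<close> of
  campaigns of the first part demands more than the groups outside the reach of the other campaigns
  of that part supply at \<open>p\<close>, while the second part satisfies a Hall condition at \<open>p\<close>. Both properties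
  pass to subcalls, so the bids arising from the first part are \<open>> p\<close> and those from the second are
  \<open>\<le> p\<close>. Hence distinct components have distinct bids, and a campaign can reach only groups whose
  component has at least its own bid.

  The bids are therefore feasible for the Lagrangian dual of (OPT): by Young's inequality
  \<open>D b * b - \<integral>\<^sub>0\<^sup>b D \<ge> D b * l - \<integral>\<^sub>0\<^sup>l D\<close>, the cost of any feasible allocation is at least
  the sum of \<open>I i * bid i\<close> over the campaigns minus the sum of \<open>\<integral>\<^sub>0\<^sup>m D j\<close> over the groups, where \<open>m\<close>
  is the bid of the component of \<open>j\<close>. Continuity makes supply equal demand in every component with
  positive bid, so that the groups with nonzero supply are fully used and the algorithm attains the
  bound.
\<close>

section \<open>Two elementary inequalities: a first-order condition and Young's inequality\<close>

text \<open>The right-hand side of the hypothesis is a quadratic in \<open>e\<close> with derivative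
  \<open>-2 * s\<close> at 0, where \<open>s\<close> is the sum in the conclusion. A minimum at the
  left end of [0, 1] forces this derivative to be nonnegative.\<close>

lemma sum_squares_first_order:
  fixes r v :: "'a \<Rightarrow> real"
  assumes min: "\<And>e. 0 \<le> e \<Longrightarrow> e \<le> 1 \<Longrightarrow> (\<Sum>i\<in>C. (r i)\<^sup>2) \<le> (\<Sum>i\<in>C. (r i - e * v i)\<^sup>2)"
  shows "(\<Sum>i\<in>C. r i * v i) \<le> 0"
proof (rule ccontr)
  define s where "s = (\<Sum>i\<in>C. r i * v i)"
  define q where "q = (\<Sum>i\<in>C. (v i)\<^sup>2)"
  assume "\<not> ?thesis"
  then have s: "s > 0" by (simp add: s_def)
  have q: "q \<ge> 0" unfolding q_def by (intro sum_nonneg) auto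
  have expand: "(\<Sum>i\<in>C. (r i - e * v i)\<^sup>2) = (\<Sum>i\<in>C. (r i)\<^sup>2) - 2 * e * s + e\<^sup>2 * q" for e
    unfolding s_def q_def
    by (simp add: power2_diff sum.distrib sum_subtractf sum_distrib_left power_mult_distrib algebra_simps)
  \<comment> \<open>Comparing at this \<open>e\<close> forces \<open>2 * s \<le> e * q\<close>. The
    denominator \<open>q + 1\<close> makes \<open>e * q \<le> s\<close> and also covers
    \<open>q = 0\<close>; the cap at 1 stays within the range of the hypothesis.\<close>
  define e where "e = min 1 (s / (q + 1))"
  have e: "0 < e" "e \<le> 1" using s q by (auto simp: e_def)
  have "2 * e * s \<le> e\<^sup>2 * q" using min[of e] e expand[of e] by auto
  then have "2 * s \<le> e * q" using e by (simp add: power2_eq_square)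
  also have "e * q \<le> s / (q + 1) * q" using q by (intro mult_right_mono) (auto simp: e_def)
  also have "\<dots> \<le> s" using s q by (simp add: field_simps)
  finally show False using s by simp
qed

text \<open>Right side minus left side is the integral of \<open>f b - f x\<close> from
  \<open>l\<close> to \<open>b\<close>. By monotonicity the integrand is nonnegative if
  \<open>l \<le> b\<close>; otherwise it is nonpositive and the orientation is reversed.\<close>

lemma Young_mono_on:
  fixes f :: "real \<Rightarrow> real"
  assumes mono: "mono_on {0..} f" and int: "\<And>a b. 0 \<le> a \<Longrightarrow> f integrable_on {a..b}"
    and "0 \<le> b" "0 \<le> l"
  shows "f b * l - integral {0..l} f \<le> f b * b - integral {0..b} f"
proof (cases "l \<le> b")
  case True
  have "integral {0..l} f + integral {l..b} f = integral {0..b} f"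
    using True assms by (intro Henstock_Kurzweil_Integration.integral_combine) auto
  moreover have "integral {l..b} f \<le> integral {l..b} (\<lambda>_. f b)"
    using assms by (intro integral_le) (auto intro: mono_onD[OF mono])
  ultimately show ?thesis using True by (simp add: algebra_simps)
next
  case False
  have "integral {0..b} f + integral {b..l} f = integral {0..l} f"
    using False assms by (intro Henstock_Kurzweil_Integration.integral_combine) auto
  moreover have "integral {b..l} (\<lambda>_. f b) \<le> integral {b..l} f"
    using assms by (intro integral_le) (auto intro: mono_onD[OF mono])
  ultimately show ?thesis using False by (simp add: algebra_simps)
qed

text \<open>With \<open>S\<close> the deficient campaigns, this passes to the second subcall the
  invariant that every group is admissible for some campaign of the same call.\<close>

lemma remaining_covered:
  assumes "T \<subseteq> \<Union>(A ` C)"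
  shows "T - T \<inter> \<Union>(A ` S) \<subseteq> \<Union>(A ` (C - S))"
  using assms by auto

section \<open>Supply curves and clearing prices\<close>

locale market =
  fixes Nc Nr :: nat and I :: "nat \<Rightarrow> real" and A :: "nat \<Rightarrow> nat set"
    and D :: "nat \<Rightarrow> real \<Rightarrow> real"
  assumes I_nonneg: "i \<in> {1..Nc} \<Longrightarrow> 0 \<le> I i"
    and A_subset: "i \<in> {1..Nc} \<Longrightarrow> A i \<subseteq> {1..Nr}"
    and D_nonneg: "j \<in> {1..Nr} \<Longrightarrow> 0 \<le> x \<Longrightarrow> 0 \<le> D j x"
    and D_mono: "j \<in> {1..Nr} \<Longrightarrow> mono_on {0..} (D j)"
    and D_continuous: "j \<in> {1..Nr} \<Longrightarrow> continuous_on {0..} (D j)"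
begin

lemma D_le: "j \<in> {1..Nr} \<Longrightarrow> 0 \<le> x \<Longrightarrow> x \<le> y \<Longrightarrow> D j x \<le> D j y"
  using D_mono[of j] by (auto simp: mono_on_def)

lemma D_integrable: "j \<in> {1..Nr} \<Longrightarrow> 0 \<le> a \<Longrightarrow> D j integrable_on {a..b}"
  by (intro integrable_continuous_real continuous_on_subset[OF D_continuous]) auto

lemma integral_D_mono:
  assumes "j \<in> {1..Nr}" "0 \<le> x" "x \<le> y"
  shows "integral {0..x} (D j) \<le> integral {0..y} (D j)"
  using assms by (intro integral_subset_le D_integrable) (auto intro: D_nonneg)

lemma integral_D_nonneg: "j \<in> {1..Nr} \<Longrightarrow> 0 \<le> integral {0..x} (D j)"
  by (intro integral_nonneg D_integrable) (auto intro: D_nonneg)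

lemma sum_D_le:
  assumes "Ct \<subseteq> {1..Nr}" "0 \<le> x" "x \<le> y"
  shows "(\<Sum>j\<in>Ct. D j x) \<le> (\<Sum>j\<in>Ct. D j y)"
  using assms by (intro sum_mono D_le) auto

lemma is_price_le:
  assumes "Ct \<subseteq> {1..Nr}" "is_price I D Cc Ct p" "0 \<le> q" "sum I Cc \<le> (\<Sum>j\<in>Ct. D j q)"
  shows "p \<le> q"
  using assms unfolding is_price_def by force

lemma is_price_gt:
  assumes "Ct \<subseteq> {1..Nr}" "is_price I D Cc Ct p" "(\<Sum>j\<in>Ct. D j q) < sum I Cc"
  shows "q < p"
proof (rule ccontr)
  assume "\<not> q < p"
  then have "(\<Sum>j\<in>Ct. D j p) \<le> (\<Sum>j\<in>Ct. D j q)"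
    using assms by (intro sum_D_le) (auto simp: is_price_def)
  then show False using assms by (auto simp: is_price_def)
qed

text \<open>Continuity prevents supply from jumping past demand: by the intermediate value theorem
  they agree somewhere in [0, p], and by minimality of the price not before \<open>p\<close>.
  Positivity of \<open>p\<close> matters, since at price 0 supply may exceed demand.\<close>

lemma is_price_clears:
  assumes Ct: "Ct \<subseteq> {1..Nr}" and p: "is_price I D Cc Ct p" "p > 0"
  shows "(\<Sum>j\<in>Ct. D j p) = sum I Cc"
proof -
  have "continuous_on {0..} (\<lambda>x. \<Sum>j\<in>Ct. D j x)"
    using Ct by (intro continuous_on_sum D_continuous) auto
  then have "continuous_on {0..p} (\<lambda>x. \<Sum>j\<in>Ct. D j x)"
    by (rule continuous_on_subset) auto
  moreover have "(\<Sum>j\<in>Ct. D j 0) \<le> sum I Cc" "sum I Cc \<le> (\<Sum>j\<in>Ct. D j p)"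
    using p by (auto simp: is_price_def intro: less_imp_le)
  ultimately obtain x where x: "0 \<le> x" "x \<le> p" "(\<Sum>j\<in>Ct. D j x) = sum I Cc"
    using IVT'[of "\<lambda>x. \<Sum>j\<in>Ct. D j x" 0 "sum I Cc" p] p by auto
  then have "\<not> x < p" using p by (auto simp: is_price_def)
  then show ?thesis using x by simp
qed

subsection \<open>Optimal solutions of ALLOC\<close>

text \<open>As \<open>t\<close> vanishes off the admissible pairs, each capacity sum may run over
  all of \<open>Cc\<close>. The index set is then the same for every group, which suits the later
  exchanges of summation.\<close>

lemma alloc_feasible_alt:
  assumes "Cc \<subseteq> {1..Nc}"
  shows "alloc_feasible Nc A Cc Ct t \<longleftrightarrow>
    (\<forall>i j. 0 \<le> t i j) \<and> (\<forall>i j. t i j \<noteq> 0 \<longrightarrow> i \<in> Cc \<and> j \<in> A i \<and> j \<in> Ct) \<and>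
    (\<forall>j\<in>Ct. (\<Sum>i\<in>Cc. t i j) \<le> 1)"
proof -
  have *: "(\<Sum>i\<in>bidders Nc A j \<inter> Cc. t i j) = (\<Sum>i\<in>Cc. t i j)"
    if "\<forall>i j. t i j \<noteq> 0 \<longrightarrow> i \<in> Cc \<and> j \<in> A i \<and> j \<in> Ct" for j
    using assms that finite_subset[OF assms]
    by (intro sum.mono_neutral_left) (auto simp: bidders_def)
  have supp: "(\<forall>i j. if i \<in> Cc \<and> j \<in> A i \<inter> Ct then 0 \<le> t i j else t i j = 0) \<longleftrightarrow>
    (\<forall>i j. 0 \<le> t i j) \<and> (\<forall>i j. t i j \<noteq> 0 \<longrightarrow> i \<in> Cc \<and> j \<in> A i \<and> j \<in> Ct)"
    by (smt (verit, best) IntE IntI)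
  show ?thesis
  proof (cases "\<forall>i j. t i j \<noteq> 0 \<longrightarrow> i \<in> Cc \<and> j \<in> A i \<and> j \<in> Ct")
    case True
    show ?thesis unfolding alloc_feasible_def supp by (simp only: *[OF True] conj_assoc)
  next
    case False
    then show ?thesis unfolding alloc_feasible_def supp by blast
  qed
qed

lemma delivered_alt:
  assumes "Ct \<subseteq> {1..Nr}" "\<And>j. t i j \<noteq> 0 \<Longrightarrow> j \<in> A i"
  shows "delivered A D Ct p t i = (\<Sum>j\<in>Ct. t i j * D j p)"
  unfolding delivered_def using assms finite_subset[OF assms(1)]
  by (intro sum.mono_neutral_left) auto

text \<open>The supply counted is that of the groups which no campaign of \<open>Cc\<close> outside
  \<open>S\<close> can reach. Quantifying over all \<open>S\<close> makes the condition pass to the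
  second part of a further split.\<close>

definition overdemanded :: "nat set \<Rightarrow> nat set \<Rightarrow> real \<Rightarrow> bool" where
  "overdemanded Cc Ct q \<longleftrightarrow>
    (\<forall>S\<subseteq>Cc. S \<noteq> {} \<longrightarrow> (\<Sum>j\<in>Ct - \<Union>(A ` (Cc - S)). D j q) < sum I S)"

text \<open>Hall's condition for serving all campaigns fractionally at price \<open>q\<close>.
  Quantifying over all \<open>S\<close> makes it pass to the first part of a further split.\<close>

definition servable :: "nat set \<Rightarrow> nat set \<Rightarrow> real \<Rightarrow> bool" where
  "servable Cc Ct q \<longleftrightarrow> (\<forall>S\<subseteq>Cc. sum I S \<le> (\<Sum>j\<in>Ct \<inter> \<Union>(A ` S). D j q))"

context
  fixes Cc Ct p t
  assumes Cc: "Cc \<subseteq> {1..Nc}" and Ct: "Ct \<subseteq> {1..Nr}" and p: "0 \<le> p"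
    and opt: "is_arg_min (alloc_cost I A D Cc Ct p) (alloc_feasible Nc A Cc Ct) t"
begin

lemma alloc_finite: "finite Cc" "finite Ct"
  using Cc Ct finite_subset by auto

text \<open>The feasible set is convex and delivery is linear in the allocation, so the segment from
  \<open>t\<close> to \<open>s\<close> is feasible and the residuals along it have the form needed
  in \<open>sum_squares_first_order\<close>.\<close>

lemma alloc_first_order:
  assumes s: "alloc_feasible Nc A Cc Ct s"
  shows "(\<Sum>i\<in>Cc. (I i - delivered A D Ct p t i) *
    (delivered A D Ct p s i - delivered A D Ct p t i)) \<le> 0"
proof (rule sum_squares_first_order)
  fix e :: real
  assume e: "0 \<le> e" "e \<le> 1"
  have t: "alloc_feasible Nc A Cc Ct t" using opt by (simp add: is_arg_min_def)
  define u where "u i j = (1 - e) * t i j + e * s i j" for i j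
  have "alloc_feasible Nc A Cc Ct u"
    unfolding alloc_feasible_alt[OF Cc]
  proof (intro conjI allI ballI impI)
    fix j assume j: "j \<in> Ct"
    have "(\<Sum>i\<in>Cc. u i j) = (1 - e) * (\<Sum>i\<in>Cc. t i j) + e * (\<Sum>i\<in>Cc. s i j)"
      by (simp add: u_def sum.distrib sum_distrib_left)
    also have "\<dots> \<le> 1"
      using s t e j unfolding alloc_feasible_alt[OF Cc] by (intro convex_bound_le) auto
    finally show "(\<Sum>i\<in>Cc. u i j) \<le> 1" .
  next
    fix i j show "0 \<le> u i j"
      using s t e unfolding alloc_feasible_alt[OF Cc] by (auto simp: u_def)
  next
    fix i j assume "u i j \<noteq> 0"
    then have "s i j \<noteq> 0 \<or> t i j \<noteq> 0" by (auto simp: u_def)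
    then show "i \<in> Cc" "j \<in> A i" "j \<in> Ct"
      using s t unfolding alloc_feasible_alt[OF Cc] by blast+
  qed
  then have "alloc_cost I A D Cc Ct p t \<le> alloc_cost I A D Cc Ct p u"
    using opt by (auto simp: is_arg_min_def not_less)
  moreover have "delivered A D Ct p u i = delivered A D Ct p t i
      + e * (delivered A D Ct p s i - delivered A D Ct p t i)" for i
    by (simp add: delivered_def u_def sum_distrib_left sum.distrib sum_subtractf algebra_simps)
  ultimately show "(\<Sum>i\<in>Cc. (I i - delivered A D Ct p t i)\<^sup>2) \<le>
    (\<Sum>i\<in>Cc. (I i - delivered A D Ct p t i -
      e * (delivered A D Ct p s i - delivered A D Ct p t i))\<^sup>2)"
    by (simp add: alloc_cost_def diff_diff_eq)
qed

lemma alloc_feasible_opt: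
  shows alloc_nonneg: "0 \<le> t i j"
    and alloc_support: "t i j \<noteq> 0 \<Longrightarrow> i \<in> Cc \<and> j \<in> A i \<and> j \<in> Ct"
    and alloc_sum_le: "j \<in> Ct \<Longrightarrow> (\<Sum>i\<in>Cc. t i j) \<le> 1"
  using opt unfolding is_arg_min_def alloc_feasible_alt[OF Cc] by blast+

lemma delivered_opt: "delivered A D Ct p t i = (\<Sum>j\<in>Ct. t i j * D j p)"
  using alloc_support Ct by (intro delivered_alt) auto

text \<open>Compare with the allocation that takes everything away from \<open>i\<close>. Only
  \<open>i\<close> enters the first-order condition, and a delivery above \<open>I i \<ge> 0\<close>
  would make its term a product of two negative numbers.\<close>

lemma no_overdelivery:
  assumes i: "i \<in> Cc"
  shows "delivered A D Ct p t i \<le> I i"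
proof (rule ccontr)
  assume over: "\<not> ?thesis"
  define s where "s k j = (if k = i then 0 else t k j)" for k j
  have "(\<Sum>k\<in>Cc. s k j) \<le> 1" if "j \<in> Ct" for j
  proof -
    have "(\<Sum>k\<in>Cc. s k j) \<le> (\<Sum>k\<in>Cc. t k j)"
      using alloc_nonneg by (intro sum_mono) (simp add: s_def)
    then show ?thesis using alloc_sum_le[OF that] by linarith
  qed
  moreover have "0 \<le> s k j" for k j using alloc_nonneg by (simp add: s_def)
  moreover have "k \<in> Cc \<and> j \<in> A k \<and> j \<in> Ct" if "s k j \<noteq> 0" for k j
    using that alloc_support by (simp add: s_def split: if_splits)
  ultimately have "alloc_feasible Nc A Cc Ct s" unfolding alloc_feasible_alt[OF Cc] by blast
  note alloc_first_order[OF this]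
  moreover have "delivered A D Ct p s k = (if k = i then 0 else delivered A D Ct p t k)" for k
    by (simp add: delivered_def s_def)
  then have "(\<Sum>k\<in>Cc. (I k - delivered A D Ct p t k) *
      (delivered A D Ct p s k - delivered A D Ct p t k)) =
      (\<Sum>k\<in>Cc. if k = i then (I i - delivered A D Ct p t i) * (- delivered A D Ct p t i) else 0)"
    by (intro sum.cong) auto
  ultimately have "(I i - delivered A D Ct p t i) * (- delivered A D Ct p t i) \<le> 0"
    using i alloc_finite by simp
  moreover have "0 \<le> I i" using i Cc I_nonneg by auto
  ultimately show False using over by (auto simp: zero_le_mult_iff)
qed

text \<open>Otherwise handing the share of \<open>j\<close> not used by deficient campaigns to \<open>i\<close> would be a descent
  direction: campaigns with zero residual do not contribute to the first-order condition.\<close>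
lemma deficient_use_all:
  fixes i j :: nat
  defines "Cc1 \<equiv> {i \<in> Cc. I i \<noteq> delivered A D Ct p t i}"
  assumes i: "i \<in> Cc1" and j: "j \<in> Ct" "j \<in> A i" and pos: "D j p \<noteq> 0"
  shows "(\<Sum>k\<in>Cc1. t k j) = 1" and "k \<in> Cc - Cc1 \<Longrightarrow> t k j = 0"
proof -
  have fin: "finite Cc1" "Cc1 \<subseteq> Cc" using alloc_finite by (auto simp: Cc1_def)
  have split: "(\<Sum>k\<in>Cc. t k j) = (\<Sum>k\<in>Cc1. t k j) + (\<Sum>k\<in>Cc - Cc1. t k j)"
    using fin alloc_finite by (simp add: sum.subset_diff[of Cc1 Cc])
  have rest: "0 \<le> (\<Sum>k\<in>Cc - Cc1. t k j)" by (intro sum_nonneg alloc_nonneg)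
  define w where "w = 1 - (\<Sum>k\<in>Cc1. t k j)"
  have w: "0 \<le> w" using alloc_sum_le[OF j(1)] split rest by (simp add: w_def)
  define s where "s k l = (if l \<noteq> j then t k l else if k = i then t i j + w
      else if k \<in> Cc1 then t k j else 0)" for k l
  have sj: "(\<Sum>k\<in>Cc. s k j) = 1"
  proof -
    have "(\<Sum>k\<in>Cc. s k j) = (\<Sum>k\<in>Cc1. s k j)"
      using fin alloc_finite i by (intro sum.mono_neutral_right) (auto simp: s_def)
    also have "\<dots> = (\<Sum>k\<in>Cc1. t k j + (if k = i then w else 0))"
      by (intro sum.cong) (auto simp: s_def)
    also have "\<dots> = 1" using fin i by (simp add: sum.distrib w_def)
    finally show ?thesis .
  qed
  have "alloc_feasible Nc A Cc Ct s"
    unfolding alloc_feasible_alt[OF Cc]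
  proof (intro conjI allI ballI impI)
    fix l assume "l \<in> Ct"
    show "(\<Sum>k\<in>Cc. s k l) \<le> 1"
    proof (cases "l = j")
      case False
      then show ?thesis using alloc_sum_le[OF \<open>l \<in> Ct\<close>] by (simp add: s_def)
    qed (simp add: sj)
  next
    fix k l show "0 \<le> s k l" using w alloc_nonneg by (auto simp: s_def)
  next
    fix k l assume "s k l \<noteq> 0"
    then show "k \<in> Cc" "l \<in> A k" "l \<in> Ct"
      using alloc_support i j fin by (auto simp: s_def split: if_splits)
  qed
  note s = this
  have ds: "delivered A D Ct p s k - delivered A D Ct p t k = (s k j - t k j) * D j p" for k
  proof -
    have "delivered A D Ct p s k = (\<Sum>l\<in>Ct. s k l * D l p)"
      using s Ct unfolding alloc_feasible_alt[OF Cc] by (intro delivered_alt) auto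
    then have "delivered A D Ct p s k - delivered A D Ct p t k =
        (\<Sum>l\<in>Ct. (s k l - t k l) * D l p)"
      by (simp add: delivered_opt sum_subtractf algebra_simps)
    also have "\<dots> = (\<Sum>l\<in>Ct. if l = j then (s k j - t k j) * D j p else 0)"
      by (intro sum.cong) (auto simp: s_def)
    finally show ?thesis using j alloc_finite by simp
  qed
  have "(\<Sum>k\<in>Cc. (I k - delivered A D Ct p t k) * ((s k j - t k j) * D j p)) =
      (\<Sum>k\<in>Cc. if k = i then (I i - delivered A D Ct p t i) * (w * D j p) else 0)"
    using i by (intro sum.cong) (auto simp: s_def Cc1_def)
  then have "(I i - delivered A D Ct p t i) * (w * D j p) \<le> 0"
    using alloc_first_order[OF s] i fin alloc_finite by (auto simp: ds)
  moreover have "I i - delivered A D Ct p t i > 0"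
    using i no_overdelivery[of i] by (auto simp: Cc1_def)
  moreover have "D j p > 0" using D_nonneg[of j p] pos p Ct j by force
  ultimately have "w \<le> 0" by (simp add: mult_le_0_iff)
  then show 1: "(\<Sum>k\<in>Cc1. t k j) = 1" using w by (simp add: w_def)
  then have "(\<Sum>k\<in>Cc - Cc1. t k j) = 0"
    using alloc_sum_le[OF j(1)] split rest by simp
  then show "t k j = 0" if "k \<in> Cc - Cc1"
    using that alloc_finite alloc_nonneg by (subst (asm) sum_nonneg_eq_0_iff) auto
qed

text \<open>By \<open>deficient_use_all\<close>, deficient campaigns use up every group in their
  reach that has nonzero supply at \<open>p\<close>. A group out of reach of the deficient campaigns
  outside \<open>S\<close> is therefore used up by \<open>S\<close> alone, yet every member of
  \<open>S\<close> receives strictly less than it demands.\<close>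

lemma split_overdemanded:
  defines "Cc1 \<equiv> {i \<in> Cc. I i \<noteq> delivered A D Ct p t i}"
  shows "overdemanded Cc1 (Ct \<inter> \<Union>(A ` Cc1)) p"
  unfolding overdemanded_def
proof (intro allI impI)
  fix S assume S: "S \<subseteq> Cc1" "S \<noteq> {}"
  have fin: "finite Cc1" "finite S" using alloc_finite S by (auto simp: Cc1_def intro: finite_subset)
  define T where "T = Ct \<inter> \<Union>(A ` Cc1) - \<Union>(A ` (Cc1 - S))"
  have T: "T \<subseteq> Ct" by (auto simp: T_def)
  have D_T: "D j p = (\<Sum>i\<in>S. t i j * D j p)" if j: "j \<in> T" for j
  proof (cases "D j p = 0")
    case False
    obtain i where i: "i \<in> Cc1" "j \<in> A i" "j \<in> Ct" using j by (auto simp: T_def)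
    have "(\<Sum>k\<in>S. t k j) = (\<Sum>k\<in>Cc1. t k j)"
      using fin S j alloc_support by (intro sum.mono_neutral_left) (auto simp: T_def)
    also have "\<dots> = 1"
      unfolding Cc1_def using i False by (intro deficient_use_all(1)) (auto simp: Cc1_def)
    finally show ?thesis by (simp flip: sum_distrib_right)
  qed simp
  have "(\<Sum>j\<in>T. D j p) = (\<Sum>j\<in>T. \<Sum>i\<in>S. t i j * D j p)"
    using D_T by (intro sum.cong) auto
  also have "\<dots> = (\<Sum>i\<in>S. \<Sum>j\<in>T. t i j * D j p)" by (rule sum.swap)
  also have "\<dots> \<le> (\<Sum>i\<in>S. delivered A D Ct p t i)"
    unfolding delivered_opt using T alloc_finite Ct p
    by (intro sum_mono sum_mono2 mult_nonneg_nonneg alloc_nonneg D_nonneg) auto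
  also have "\<dots> < sum I S"
    using fin S no_overdelivery by (intro sum_strict_mono) (force simp: Cc1_def)+
  finally show "(\<Sum>j\<in>Ct \<inter> \<Union>(A ` Cc1) - \<Union>(A ` (Cc1 - S)). D j p) < sum I S"
    by (simp add: T_def)
qed

text \<open>The other campaigns receive exactly their demand. By \<open>deficient_use_all\<close>
  none of it comes from groups within reach of a deficient campaign, so the remaining groups alone
  provide it.\<close>

lemma split_servable:
  defines "Cc1 \<equiv> {i \<in> Cc. I i \<noteq> delivered A D Ct p t i}"
  shows "servable (Cc - Cc1) (Ct - Ct \<inter> \<Union>(A ` Cc1)) p"
  unfolding servable_def
proof (intro allI impI)
  fix S assume S: "S \<subseteq> Cc - Cc1"
  define T where "T = (Ct - Ct \<inter> \<Union>(A ` Cc1)) \<inter> \<Union>(A ` S)"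
  have T: "T \<subseteq> Ct" by (auto simp: T_def)
  have zero: "t i j * D j p = 0" if ij: "i \<in> S" "j \<in> Ct - T" for i j
  proof (rule ccontr)
    assume nz: "t i j * D j p \<noteq> 0"
    then have "j \<in> A i" using alloc_support by auto
    then obtain k where k: "k \<in> Cc1" "j \<in> A k" using ij by (auto simp: T_def)
    then have "t i j = 0"
      using ij S nz k by (intro deficient_use_all(2)[where i = k]) (auto simp: Cc1_def)
    then show False using nz by simp
  qed
  have "sum I S = (\<Sum>i\<in>S. delivered A D Ct p t i)"
    using S by (intro sum.cong) (auto simp: Cc1_def)
  also have "\<dots> = (\<Sum>i\<in>S. \<Sum>j\<in>T. t i j * D j p)"
    unfolding delivered_opt using T alloc_finite zero
    by (intro sum.cong sum.mono_neutral_right) auto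
  also have "\<dots> = (\<Sum>j\<in>T. (\<Sum>i\<in>S. t i j) * D j p)"
    by (subst sum.swap) (simp add: sum_distrib_right)
  also have "\<dots> \<le> (\<Sum>j\<in>T. 1 * D j p)"
  proof (intro sum_mono mult_right_mono)
    fix j assume j: "j \<in> T"
    have "(\<Sum>i\<in>S. t i j) \<le> (\<Sum>i\<in>Cc. t i j)"
      using S alloc_finite alloc_nonneg by (intro sum_mono2) auto
    then show "(\<Sum>i\<in>S. t i j) \<le> 1" using alloc_sum_le[of j] j T by auto
    show "0 \<le> D j p" using j T Ct p by (intro D_nonneg) auto
  qed
  finally show "sum I S \<le> (\<Sum>j\<in>(Ct - Ct \<inter> \<Union>(A ` Cc1)) \<inter> \<Union>(A ` S). D j p)"
    by (simp add: T_def)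
qed

lemma deficient_nonempty:
  assumes "alloc_cost I A D Cc Ct p t \<noteq> 0"
  shows "{i \<in> Cc. I i \<noteq> delivered A D Ct p t i} \<noteq> {}"
proof
  assume "{i \<in> Cc. I i \<noteq> delivered A D Ct p t i} = {}"
  then have "\<forall>i\<in>Cc. I i = delivered A D Ct p t i" by auto
  then show False using assms by (simp add: alloc_cost_def)
qed

end

subsection \<open>Runs of the procedure\<close>

lemma servable_total:
  assumes "servable Cc Ct q" "Ct \<subseteq> {1..Nr}" "0 \<le> q"
  shows "sum I Cc \<le> (\<Sum>j\<in>Ct. D j q)"
proof -
  have "sum I Cc \<le> (\<Sum>j\<in>Ct \<inter> \<Union>(A ` Cc). D j q)"
    using assms(1) by (auto simp: servable_def)
  also have "\<dots> \<le> (\<Sum>j\<in>Ct. D j q)"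
    using assms(2,3) finite_subset[of Ct] by (intro sum_mono2 D_nonneg) auto
  finally show ?thesis .
qed

text \<open>At a split the first part keeps all groups of \<open>Ct\<close> its campaigns can reach,
  so it is servable at the same \<open>q\<close>. The second part is servable at the current price
  \<open>p\<close>, and \<open>p \<le> q\<close> because total supply at \<open>q\<close> covers
  total demand. Hence \<open>q\<close> varies in the induction.\<close>

lemma servable_bid_le:
  assumes "rec_run Nc I A D Cc Ct out" "Cc \<subseteq> {1..Nc}" "Ct \<subseteq> {1..Nr}"
    and "servable Cc Ct q" "0 \<le> q" "c \<in> out"
  shows "bid c \<le> q"
  using assms
proof (induction arbitrary: q c rule: rec_run.induct)
  case (stop Cc Ct p t)
  have "p \<le> q"
    using is_price_le[OF stop.prems(2) stop.hyps(1) stop.prems(4)] servable_total stop.prems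
    by blast
  then show ?case using stop.prems by simp
next
  case (split Cc Ct p t Cc1 Ct1 out1 out2)
  have p: "0 \<le> p" using split.hyps by (simp add: is_price_def)
  show ?case
  proof (cases "c \<in> out1")
    case True
    have "Ct1 \<inter> \<Union>(A ` S) = Ct \<inter> \<Union>(A ` S)" if "S \<subseteq> Cc1" for S
      using that unfolding split.hyps(5) by auto
    moreover have "S \<subseteq> Cc" if "S \<subseteq> Cc1" for S using that split.hyps(4) by auto
    ultimately have "servable Cc1 Ct1 q"
      using \<open>servable Cc Ct q\<close> unfolding servable_def by simp
    moreover have "Cc1 \<subseteq> {1..Nc}" "Ct1 \<subseteq> {1..Nr}"
      using split.prems split.hyps(4,5) by auto
    ultimately show ?thesis using split.prems(4) True by (intro split.IH(1))
  next
    case False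
    then have c: "c \<in> out2" using split.prems by simp
    have sub: "Cc - Cc1 \<subseteq> {1..Nc}" "Ct - Ct1 \<subseteq> {1..Nr}" using split.prems by auto
    have "servable (Cc - Cc1) (Ct - Ct1) p"
      unfolding split.hyps(4,5) using split.prems(1,2) p split.hyps(2) by (rule split_servable)
    then have "bid c \<le> p"
      using c sub p by (intro split.IH(2))
    also have "p \<le> q"
      using is_price_le[OF split.prems(2) split.hyps(1) split.prems(4)] servable_total split.prems
      by blast
    finally show ?thesis .
  qed
qed

text \<open>The mirror image of \<open>servable_bid_le\<close>: the first part is overdemanded at
  the current price \<open>p\<close>, which exceeds \<open>q\<close>, and the second part inherits
  the condition at \<open>q\<close>. Taking \<open>S = Cc\<close> yields the strict inequality of
  totals, hence the nonemptiness requirement.\<close>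

lemma overdemanded_bid_gt:
  assumes "rec_run Nc I A D Cc Ct out" "Cc \<subseteq> {1..Nc}" "Ct \<subseteq> {1..Nr}"
    and "Ct \<subseteq> \<Union>(A ` Cc)" "Cc \<noteq> {}" "overdemanded Cc Ct q" "c \<in> out"
  shows "q < bid c"
  using assms
proof (induction arbitrary: q c rule: rec_run.induct)
  case (stop Cc Ct p t)
  have "(\<Sum>j\<in>Ct. D j q) < sum I Cc"
    using stop.prems(4,5) unfolding overdemanded_def by (auto dest: spec[of _ Cc])
  then show ?case using is_price_gt[OF stop.prems(2) stop.hyps(1)] stop.prems(6) by simp
next
  case (split Cc Ct p t Cc1 Ct1 out1 out2)
  have p: "0 \<le> p" using split.hyps by (simp add: is_price_def)
  have over1: "overdemanded Cc1 Ct1 p"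
    unfolding split.hyps(4,5) using split.prems(1,2) p split.hyps(2) by (rule split_overdemanded)
  have ne1: "Cc1 \<noteq> {}"
    unfolding split.hyps(4) using split.prems(1,2) p split.hyps(2,3) by (rule deficient_nonempty)
  have "Cc1 \<subseteq> Cc" using split.hyps(4) by auto
  have "Ct1 \<subseteq> Ct" using split.hyps(5) by simp
  have sub: "Cc1 \<subseteq> {1..Nc}" "Ct1 \<subseteq> {1..Nr}" "Cc - Cc1 \<subseteq> {1..Nc}" "Ct - Ct1 \<subseteq> {1..Nr}"
    using split.prems(1,2) \<open>Cc1 \<subseteq> Cc\<close> \<open>Ct1 \<subseteq> Ct\<close> by auto
  have cover: "Ct1 \<subseteq> \<Union>(A ` Cc1)" "Ct - Ct1 \<subseteq> \<Union>(A ` (Cc - Cc1))"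
    using split.hyps(5) remaining_covered[OF split.prems(3), of Cc1] by simp_all
  show ?case
  proof (cases "c \<in> out1")
    case True
    have "(\<Sum>j\<in>Ct. D j q) < sum I Cc"
      using split.prems(4,5) unfolding overdemanded_def by (auto dest: spec[of _ Cc])
    then have "q < p" using is_price_gt[OF split.prems(2) split.hyps(1)] by simp
    also have "p < bid c"
      using True over1 ne1 sub cover by (intro split.IH(1))
    finally show ?thesis .
  next
    case False
    then have c: "c \<in> out2" using split.prems by simp
    \<comment> \<open>If all campaigns were deficient, covering would give \<open>Ct1 = Ct\<close>,
      and overdemand at \<open>p\<close> would contradict that supply at the price \<open>p\<close>
      meets total demand.\<close>
    have ne2: "Cc - Cc1 \<noteq> {}"
    proof
      assume "Cc - Cc1 = {}"
      then have eq: "Cc1 = Cc" using split.hyps(4) by auto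
      then have "Ct1 = Ct" using split.prems(3) split.hyps(5) by auto
      with over1 eq ne1 have "(\<Sum>j\<in>Ct. D j p) < sum I Cc"
        unfolding overdemanded_def by (auto dest: spec[of _ Cc])
      then show False using split.hyps(1) by (auto simp: is_price_def)
    qed
    have "Ct - Ct1 - \<Union>(A ` (Cc - Cc1 - S)) = Ct - \<Union>(A ` (Cc - S))"
      if "S \<subseteq> Cc - Cc1" for S
      using that \<open>Cc1 \<subseteq> Cc\<close> unfolding split.hyps(5) by auto
    moreover have "S \<subseteq> Cc" if "S \<subseteq> Cc - Cc1" for S using that by auto
    ultimately have "overdemanded (Cc - Cc1) (Ct - Ct1) q"
      using \<open>overdemanded Cc Ct q\<close> unfolding overdemanded_def by simp
    then show ?thesis
      using c ne2 sub cover by (intro split.IH(2))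
  qed
qed

section \<open>Clearing and separation of the output components\<close>

definition cleared :: "component \<Rightarrow> bool" where
  "cleared c \<longleftrightarrow> is_price I D (campaigns c) (targets c) (bid c) \<and>
     alloc_feasible Nc A (campaigns c) (targets c) (fraction c) \<and>
     (\<forall>i\<in>campaigns c. delivered A D (targets c) (bid c) (fraction c) i = I i)"

lemma rec_run_cleared:
  assumes "rec_run Nc I A D Cc Ct out" "Cc \<subseteq> {1..Nc}" "c \<in> out"
  shows "cleared c"
  using assms
proof (induction arbitrary: c rule: rec_run.induct)
  case (stop Cc Ct p t)
  have "finite Cc" using stop.prems finite_subset by blast
  then show ?case
    using stop by (auto simp: cleared_def is_arg_min_def alloc_cost_def sum_nonneg_eq_0_iff)
next
  case (split Cc Ct p t Cc1 Ct1 out1 out2)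
  have "Cc1 \<subseteq> {1..Nc}" "Cc - Cc1 \<subseteq> {1..Nc}" using split.prems split.hyps(4) by auto
  then show ?case using split.IH split.prems by auto
qed

lemma rec_run_finite: "rec_run Nc I A D Cc Ct out \<Longrightarrow> finite out"
  by (induction rule: rec_run.induct) auto

lemma rec_run_Union:
  "rec_run Nc I A D Cc Ct out \<Longrightarrow> \<Union>(campaigns ` out) = Cc \<and> \<Union>(targets ` out) = Ct"
proof (induction rule: rec_run.induct)
  case (split Cc Ct p t Cc1 Ct1 out1 out2)
  have "Cc1 \<subseteq> Cc" "Ct1 \<subseteq> Ct" using split.hyps(4,5) by auto
  then show ?case
    unfolding image_Un Union_Un_distrib split.IH[THEN conjunct1] split.IH[THEN conjunct2] by auto
qed simp

text \<open>At each split the current price \<open>p\<close> separates the bids: those of the first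
  part lie strictly above it, those of the second at or below it. The last clause becomes
  feasibility of the dual values in \<open>alg_cost_le\<close>.\<close>

lemma rec_run_separated:
  assumes "rec_run Nc I A D Cc Ct out" "Cc \<subseteq> {1..Nc}" "Ct \<subseteq> {1..Nr}" "Ct \<subseteq> \<Union>(A ` Cc)"
    and "c \<in> out" "d \<in> out"
  shows "(c \<noteq> d \<longrightarrow> bid c \<noteq> bid d \<and> campaigns c \<inter> campaigns d = {} \<and> targets c \<inter> targets d = {}) \<and>
    (\<forall>i\<in>campaigns c. A i \<inter> targets d \<noteq> {} \<longrightarrow> bid c \<le> bid d)"
  using assms
proof (induction arbitrary: c d rule: rec_run.induct)
  case (stop Cc Ct p t)
  then show ?case by auto
next
  case (split Cc Ct p t Cc1 Ct1 out1 out2)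
  have p: "0 \<le> p" using split.hyps by (simp add: is_price_def)
  have over: "overdemanded Cc1 Ct1 p"
    unfolding split.hyps(4,5) using split.prems(1,2) p split.hyps(2) by (rule split_overdemanded)
  have ne: "Cc1 \<noteq> {}"
    unfolding split.hyps(4) using split.prems(1,2) p split.hyps(2,3) by (rule deficient_nonempty)
  have serv: "servable (Cc - Cc1) (Ct - Ct1) p"
    unfolding split.hyps(4,5) using split.prems(1,2) p split.hyps(2) by (rule split_servable)
  have "Cc1 \<subseteq> Cc" using split.hyps(4) by auto
  have "Ct1 \<subseteq> Ct" using split.hyps(5) by simp
  have sub: "Cc1 \<subseteq> {1..Nc}" "Ct1 \<subseteq> {1..Nr}" "Cc - Cc1 \<subseteq> {1..Nc}" "Ct - Ct1 \<subseteq> {1..Nr}"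
    using split.prems(1,2) \<open>Cc1 \<subseteq> Cc\<close> \<open>Ct1 \<subseteq> Ct\<close> by auto
  have cover: "Ct1 \<subseteq> \<Union>(A ` Cc1)" "Ct - Ct1 \<subseteq> \<Union>(A ` (Cc - Cc1))"
    using split.hyps(5) remaining_covered[OF split.prems(3), of Cc1] by simp_all
  have gt: "p < bid x" if "x \<in> out1" for x
    using overdemanded_bid_gt[OF split.hyps(6) sub(1,2) cover(1) ne over that] .
  have le: "bid x \<le> p" if "x \<in> out2" for x
    using servable_bid_le[OF split.hyps(7) sub(3,4) serv p that] .
  have part1: "campaigns x \<subseteq> Cc1" "targets x \<subseteq> Ct1" if "x \<in> out1" for x
    using rec_run_Union[OF split.hyps(6)] that by auto
  have part2: "campaigns x \<subseteq> Cc - Cc1" "targets x \<subseteq> Ct - Ct1" if "x \<in> out2" for x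
    using rec_run_Union[OF split.hyps(7)] that by auto
  \<comment> \<open>The asymmetry is essential: \<open>Ct1\<close> takes every group within reach of
    \<open>Cc1\<close>, so the first part reaches no group of the second, while the second part may
    reach groups of the first, where bids are higher.\<close>
  have cross: "bid y < bid x \<and> campaigns x \<inter> campaigns y = {} \<and> targets x \<inter> targets y = {} \<and>
      (\<forall>i\<in>campaigns x. A i \<inter> targets y = {})" if "x \<in> out1" "y \<in> out2" for x y
    using gt[OF that(1)] le[OF that(2)] part1[OF that(1)] part2[OF that(2)] split.hyps(5)
    by fastforce
  consider "c \<in> out1" "d \<in> out1" | "c \<in> out2" "d \<in> out2" | "c \<in> out1" "d \<in> out2"
    | "c \<in> out2" "d \<in> out1" using split.prems by blast
  then show ?case
  proof cases
    case 1 then show ?thesis using split.IH(1) sub cover by blast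
  next
    case 2 then show ?thesis using split.IH(2) sub cover by blast
  next
    case 3 then show ?thesis using cross[of c d] by auto
  next
    case 4 then show ?thesis using cross[of d c] by auto
  qed
qed

subsection \<open>Costs\<close>

text \<open>Exact delivery turns the first terms into demand times bid. What remains is that each
  integral is counted with total weight 1, or is zero.\<close>

lemma cleared_cost:
  assumes c: "cleared c" and Cc: "campaigns c \<subseteq> {1..Nc}" and Ct: "targets c \<subseteq> {1..Nr}"
  shows "(\<Sum>i\<in>campaigns c. \<Sum>j\<in>targets c.
      fraction c i j * (D j (bid c) * bid c - integral {0..bid c} (D j))) =
    sum I (campaigns c) * bid c - (\<Sum>j\<in>targets c. integral {0..bid c} (D j))"
proof -
  define Cc' Ct' p t where "Cc' = campaigns c" "Ct' = targets c" "p = bid c" "t = fraction c"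
  note [simp] = this(1,2,3,4)[symmetric]
  have price: "is_price I D Cc' Ct' p" and p: "0 \<le> p"
    and feas: "alloc_feasible Nc A Cc' Ct' t"
    and del: "i \<in> Cc' \<Longrightarrow> delivered A D Ct' p t i = I i" for i
    using c by (auto simp: cleared_def is_price_def)
  have Cc: "Cc' \<subseteq> {1..Nc}" and Ct: "Ct' \<subseteq> {1..Nr}" using assms by auto
  have fin: "finite Ct'" using Ct finite_subset by blast
  have t: "(\<Sum>i\<in>Cc'. t i j) \<le> 1" if "j \<in> Ct'" for j
    using feas that unfolding alloc_feasible_alt[OF Cc] by auto
  have sumI: "(\<Sum>i\<in>Cc'. \<Sum>j\<in>Ct'. t i j * D j p) = sum I Cc'"
    using feas Ct del unfolding alloc_feasible_alt[OF Cc]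
    by (intro sum.cong refl, subst delivered_alt[symmetric]) auto
  \<comment> \<open>For \<open>p > 0\<close> supply equals demand, hence delivery, so no capacity
    with nonzero supply at \<open>p\<close> is left over. If \<open>D j p = 0\<close>, monotonicity
    makes \<open>D j\<close> vanish on [0, p]; for \<open>p = 0\<close> the integral is
    trivial.\<close>
  have full: "(\<Sum>i\<in>Cc'. t i j) * integral {0..p} (D j) = integral {0..p} (D j)"
    if j: "j \<in> Ct'" for j
  proof (cases "p = 0")
    case False
    then have "(\<Sum>j\<in>Ct'. D j p) = sum I Cc'" using is_price_clears[OF Ct price] p by simp
    also have "\<dots> = (\<Sum>j\<in>Ct'. (\<Sum>i\<in>Cc'. t i j) * D j p)"
      unfolding sumI[symmetric] by (subst sum.swap) (simp add: sum_distrib_right)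
    finally have "(\<Sum>j\<in>Ct'. (1 - (\<Sum>i\<in>Cc'. t i j)) * D j p) = 0"
      by (simp add: algebra_simps sum_subtractf)
    moreover have "\<forall>j\<in>Ct'. 0 \<le> (1 - (\<Sum>i\<in>Cc'. t i j)) * D j p"
      using t D_nonneg p Ct by (auto intro!: mult_nonneg_nonneg)
    ultimately have "(1 - (\<Sum>i\<in>Cc'. t i j)) * D j p = 0"
      using fin j by (simp add: sum_nonneg_eq_0_iff)
    moreover have "integral {0..p} (D j) = 0" if "D j p = 0"
    proof -
      have "integral {0..p} (D j) = integral {0..p} (\<lambda>_. 0)"
        using D_le[of j _ p] D_nonneg[of j] that j Ct
        by (intro Henstock_Kurzweil_Integration.integral_cong) force
      then show ?thesis by simp
    qed
    ultimately show ?thesis by auto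
  qed simp
  have "(\<Sum>i\<in>Cc'. \<Sum>j\<in>Ct'. t i j * (D j p * p - integral {0..p} (D j))) =
      (\<Sum>i\<in>Cc'. \<Sum>j\<in>Ct'. t i j * D j p) * p - (\<Sum>i\<in>Cc'. \<Sum>j\<in>Ct'. t i j * integral {0..p} (D j))"
    by (simp add: right_diff_distrib sum_subtractf sum_distrib_right mult.assoc)
  also have "(\<Sum>i\<in>Cc'. \<Sum>j\<in>Ct'. t i j * integral {0..p} (D j)) =
      (\<Sum>j\<in>Ct'. (\<Sum>i\<in>Cc'. t i j) * integral {0..p} (D j))"
    by (subst sum.swap) (simp add: sum_distrib_right)
  also have "\<dots> = (\<Sum>j\<in>Ct'. integral {0..p} (D j))" using full by (intro sum.cong) auto
  finally show ?thesis using sumI by simp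
qed

text \<open>\<open>l i\<close> is the multiplier of the demand constraint of campaign \<open>i\<close>, and the integral of
  \<open>D j\<close> up to \<open>m j\<close> that of the capacity constraint of group \<open>j\<close>.\<close>
lemma weak_duality:
  assumes feas: "opt_feasible Nc Nr I A D (b, \<gamma>)"
    and l: "\<And>i. i \<in> {1..Nc} \<Longrightarrow> 0 \<le> l i"
    and lm: "\<And>i j. i \<in> {1..Nc} \<Longrightarrow> j \<in> A i \<Longrightarrow> l i \<le> m j"
  shows "(\<Sum>i=1..Nc. I i * l i) - (\<Sum>j=1..Nr. integral {0..m j} (D j)) \<le> opt_cost Nc Nr D (b, \<gamma>)"
proof -
  have pos: "0 \<le> b i j" "0 \<le> \<gamma> i j" if "i \<in> {1..Nc}" "j \<in> A i" for i j
    using feas that by (auto simp: opt_feasible_def)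
  have zero: "\<gamma> i j = 0" if "i \<in> {1..Nc}" "j \<in> {1..Nr} - A i" for i j
    using feas that by (auto simp: opt_feasible_def)
  have nonneg: "0 \<le> \<gamma> i j" if "i \<in> {1..Nc}" "j \<in> {1..Nr}" for i j
    using pos zero that by (cases "j \<in> A i") auto
  have demand: "I i \<le> (\<Sum>j=1..Nr. \<gamma> i j * D j (b i j))" if "i \<in> {1..Nc}" for i
  proof -
    have "(\<Sum>j\<in>A i. \<gamma> i j * D j (b i j)) = (\<Sum>j=1..Nr. \<gamma> i j * D j (b i j))"
      using zero A_subset that by (intro sum.mono_neutral_left) auto
    moreover have "I i \<le> (\<Sum>j\<in>A i. \<gamma> i j * D j (b i j))"
      using feas that by (auto simp: opt_feasible_def)
    ultimately show ?thesis by simp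
  qed
  have capacity: "(\<Sum>i=1..Nc. \<gamma> i j) \<le> 1" if "j \<in> {1..Nr}" for j
  proof -
    have "(\<Sum>i\<in>bidders Nc A j. \<gamma> i j) = (\<Sum>i=1..Nc. \<gamma> i j)"
      using zero that by (intro sum.mono_neutral_left) (auto simp: bidders_def)
    moreover have "(\<Sum>i\<in>bidders Nc A j. \<gamma> i j) \<le> 1"
      using feas that by (auto simp: opt_feasible_def)
    ultimately show ?thesis by simp
  qed
  have "(\<Sum>i=1..Nc. I i * l i) - (\<Sum>j=1..Nr. integral {0..m j} (D j)) \<le>
    (\<Sum>i=1..Nc. (\<Sum>j=1..Nr. \<gamma> i j * D j (b i j)) * l i)
      - (\<Sum>j=1..Nr. (\<Sum>i=1..Nc. \<gamma> i j) * integral {0..m j} (D j))"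
  proof (rule diff_mono)
    show "(\<Sum>i=1..Nc. I i * l i) \<le> (\<Sum>i=1..Nc. (\<Sum>j=1..Nr. \<gamma> i j * D j (b i j)) * l i)"
      using demand l by (intro sum_mono mult_right_mono) auto
    show "(\<Sum>j=1..Nr. (\<Sum>i=1..Nc. \<gamma> i j) * integral {0..m j} (D j)) \<le>
        (\<Sum>j=1..Nr. integral {0..m j} (D j))"
      using capacity integral_D_nonneg nonneg
      by (intro sum_mono mult_left_le_one_le sum_nonneg) auto
  qed
  also have "\<dots> = (\<Sum>i=1..Nc. \<Sum>j=1..Nr. \<gamma> i j * (D j (b i j) * l i - integral {0..m j} (D j)))"
  proof -
    have "(\<Sum>j=1..Nr. (\<Sum>i=1..Nc. \<gamma> i j) * integral {0..m j} (D j)) =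
        (\<Sum>i=1..Nc. \<Sum>j=1..Nr. \<gamma> i j * integral {0..m j} (D j))"
      by (subst sum.swap) (simp add: sum_distrib_right)
    then show ?thesis
      by (simp add: right_diff_distrib sum_subtractf sum_distrib_right mult.assoc)
  qed
  also have "\<dots> \<le> opt_cost Nc Nr D (b, \<gamma>)"
    unfolding opt_cost_def prod.case
  proof (intro sum_mono)
    fix i j assume ij: "i \<in> {1..Nc}" "j \<in> {1..Nr}"
    show "\<gamma> i j * (D j (b i j) * l i - integral {0..m j} (D j)) \<le>
      \<gamma> i j * (D j (b i j) * b i j - integral {0..b i j} (D j))"
    proof (cases "j \<in> A i")
      case True
      \<comment> \<open>Raising the upper limit from \<open>l i\<close> to \<open>m j\<close> only
        lowers the left side; Young's inequality at \<open>l i\<close> then compares with the actual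
        bid.\<close>
      have "D j (b i j) * l i - integral {0..m j} (D j) \<le>
          D j (b i j) * l i - integral {0..l i} (D j)"
        using integral_D_mono[of j "l i" "m j"] l lm ij True by simp
      also have "\<dots> \<le> D j (b i j) * b i j - integral {0..b i j} (D j)"
        using ij True l pos D_mono D_integrable by (intro Young_mono_on) auto
      finally show ?thesis using nonneg ij by (intro mult_left_mono) auto
    next
      case False then show ?thesis using zero ij by simp
    qed
  qed
  finally show ?thesis .
qed

subsection \<open>The allocation obtained by the algorithm\<close>

context
  fixes out
  assumes run: "rec_run Nc I A D {1..Nc} {1..Nr} out"
    and biddable: "{1..Nr} \<subseteq> \<Union>(A ` {1..Nc})"
begin

lemma out_Union: "\<Union>(campaigns ` out) = {1..Nc}" "\<Union>(targets ` out) = {1..Nr}"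
  using rec_run_Union[OF run] by auto

lemma out_subset: "c \<in> out \<Longrightarrow> campaigns c \<subseteq> {1..Nc}" "c \<in> out \<Longrightarrow> targets c \<subseteq> {1..Nr}"
  using out_Union by auto

lemma out_cleared: "c \<in> out \<Longrightarrow> cleared c"
  using rec_run_cleared[OF run] by auto

lemma bid_nonneg: "c \<in> out \<Longrightarrow> 0 \<le> bid c"
  using out_cleared by (auto simp: cleared_def is_price_def)

lemmas out_separated = rec_run_separated[OF run order_refl order_refl biddable]

lemma component_at_eq: "c \<in> out \<Longrightarrow> component_at out (bid c) = c"
  unfolding component_at_def using out_separated by (intro the_equality) auto

lemma component_of_eq:
  assumes "c \<in> out" "i \<in> campaigns c"
  shows "component_of out i = c"
  unfolding component_of_def
proof (rule the_equality)
  show "d = c" if "d \<in> out \<and> i \<in> campaigns d" for d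
    using out_separated[OF assms(1), of d] assms(2) that by blast
qed (use assms in simp)

lemma component_of_mem:
  assumes "i \<in> {1..Nc}"
  shows "component_of out i \<in> out" "i \<in> campaigns (component_of out i)"
proof -
  obtain c where "c \<in> out" "i \<in> campaigns c" using assms out_Union by blast
  then show "component_of out i \<in> out" "i \<in> campaigns (component_of out i)"
    using component_of_eq by auto
qed

lemma sum_campaigns: "(\<Sum>i=1..Nc. f i) = (\<Sum>c\<in>out. \<Sum>i\<in>campaigns c. f i)"
  unfolding out_Union(1)[symmetric]
proof (rule sum.UNION_disjoint[OF rec_run_finite[OF run]])
  show "\<forall>c\<in>out. finite (campaigns c)" using out_subset(1) finite_subset by blast
  show "\<forall>c\<in>out. \<forall>d\<in>out. c \<noteq> d \<longrightarrow> campaigns c \<inter> campaigns d = {}" using out_separated by simp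
qed

lemma sum_targets: "(\<Sum>j=1..Nr. f j) = (\<Sum>c\<in>out. \<Sum>j\<in>targets c. f j)"
  unfolding out_Union(2)[symmetric]
proof (rule sum.UNION_disjoint[OF rec_run_finite[OF run]])
  show "\<forall>c\<in>out. finite (targets c)" using out_subset(2) finite_subset by blast
  show "\<forall>c\<in>out. \<forall>d\<in>out. c \<noteq> d \<longrightarrow> targets c \<inter> targets d = {}" using out_separated by simp
qed

lemma fraction_facts:
  assumes "c \<in> out"
  shows fraction_nonneg: "0 \<le> fraction c i j"
    and fraction_support: "fraction c i j \<noteq> 0 \<Longrightarrow> i \<in> campaigns c \<and> j \<in> A i \<and> j \<in> targets c"
    and fraction_sum_le: "j \<in> targets c \<Longrightarrow> (\<Sum>i\<in>campaigns c. fraction c i j) \<le> 1"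
  using out_cleared[OF assms] unfolding cleared_def alloc_feasible_alt[OF out_subset(1)[OF assms]]
  by blast+

lemma alg_fraction_eq:
  assumes "i \<in> {1..Nc}"
  shows "alg_fraction out i j = fraction (component_of out i) i j"
  using fraction_support[OF component_of_mem(1)[OF assms], of i j] by (auto simp: alg_fraction_def)

lemma alg_fraction_support:
  assumes "i \<in> {1..Nc}" "j \<notin> A i"
  shows "alg_fraction out i j = 0"
  using fraction_support[OF component_of_mem(1)[OF assms(1)], of i j] assms
  by (auto simp: alg_fraction_eq)

section \<open>Feasibility, cost and optimality of the computed allocation\<close>

lemma alg_feasible: "opt_feasible Nc Nr I A D (alg_bid out, alg_fraction out)"
  unfolding opt_feasible_def prod.case
proof (intro conjI ballI)
  fix i j assume i: "i \<in> {1..Nc}"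
  show "0 \<le> alg_bid out i j" using bid_nonneg component_of_mem i by (simp add: alg_bid_def)
  show "0 \<le> alg_fraction out i j"
    using i fraction_nonneg component_of_mem by (simp add: alg_fraction_eq)
next
  fix i j assume "i \<in> {1..Nc}" "j \<in> {1..Nr} - A i"
  then show "alg_fraction out i j = 0"
    using alg_fraction_support by blast
next
  fix i assume i: "i \<in> {1..Nc}"
  define c where "c = component_of out i"
  have c: "c \<in> out" "i \<in> campaigns c" using component_of_mem[OF i] by (auto simp: c_def)
  have "I i = delivered A D (targets c) (bid c) (fraction c) i"
    using out_cleared[OF c(1)] c by (simp add: cleared_def)
  also have "\<dots> = (\<Sum>j\<in>A i. fraction c i j * D j (bid c))"
    unfolding delivered_def using finite_subset[OF A_subset[OF i]] fraction_support[OF c(1)]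
    by (intro sum.mono_neutral_left) auto
  finally show "I i \<le> (\<Sum>j\<in>A i. alg_fraction out i j * D j (alg_bid out i j))"
    using i by (simp add: alg_fraction_eq alg_bid_def c_def)
next
  fix j assume "j \<in> {1..Nr}"
  then obtain c where c: "c \<in> out" "j \<in> targets c" using out_Union by blast
  have "(\<Sum>i\<in>bidders Nc A j. alg_fraction out i j) = (\<Sum>i=1..Nc. alg_fraction out i j)"
    using alg_fraction_support by (intro sum.mono_neutral_left) (auto simp: bidders_def)
  \<comment> \<open>A campaign of another component uses only groups of its own component, and these
    do not include \<open>j\<close>.\<close>
  also have "\<dots> = (\<Sum>i\<in>campaigns c. alg_fraction out i j)"
  proof (rule sum.mono_neutral_right)
    show "campaigns c \<subseteq> {1..Nc}" using out_subset c by blast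
    show "\<forall>i\<in>{1..Nc} - campaigns c. alg_fraction out i j = 0"
    proof
      fix i assume i: "i \<in> {1..Nc} - campaigns c"
      then have "component_of out i \<noteq> c" using component_of_mem[of i] by auto
      then have "j \<notin> targets (component_of out i)"
        using out_separated[OF c(1) component_of_mem(1)[of i]] c i by auto
      then show "alg_fraction out i j = 0" by (simp add: alg_fraction_def)
    qed
  qed simp
  also have "\<dots> = (\<Sum>i\<in>campaigns c. fraction c i j)"
    using c out_subset component_of_eq by (intro sum.cong) (auto simp: alg_fraction_def)
  finally show "(\<Sum>i\<in>bidders Nc A j. alg_fraction out i j) \<le> 1"
    using fraction_sum_le c by simp
qed

lemma alg_cost:
  "opt_cost Nc Nr D (alg_bid out, alg_fraction out) =
    (\<Sum>c\<in>out. sum I (campaigns c) * bid c - (\<Sum>j\<in>targets c. integral {0..bid c} (D j)))"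
proof -
  have "opt_cost Nc Nr D (alg_bid out, alg_fraction out) =
      (\<Sum>c\<in>out. \<Sum>i\<in>campaigns c. \<Sum>j=1..Nr.
        alg_fraction out i j * (D j (alg_bid out i j) * alg_bid out i j
          - integral {0..alg_bid out i j} (D j)))"
    unfolding opt_cost_def prod.case by (rule sum_campaigns)
  also have "\<dots> = (\<Sum>c\<in>out. \<Sum>i\<in>campaigns c. \<Sum>j\<in>targets c.
      fraction c i j * (D j (bid c) * bid c - integral {0..bid c} (D j)))"
  proof (intro sum.cong[OF refl])
    fix c i assume ci: "c \<in> out" "i \<in> campaigns c"
    have "(\<Sum>j=1..Nr. alg_fraction out i j * (D j (alg_bid out i j) * alg_bid out i j
        - integral {0..alg_bid out i j} (D j))) =
      (\<Sum>j=1..Nr. if j \<in> targets c then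
        fraction c i j * (D j (bid c) * bid c - integral {0..bid c} (D j)) else 0)"
      using component_of_eq[OF ci] by (intro sum.cong) (auto simp: alg_fraction_def alg_bid_def)
    also have "\<dots> = (\<Sum>j\<in>targets c.
        fraction c i j * (D j (bid c) * bid c - integral {0..bid c} (D j)))"
      using out_subset(2)[OF ci(1)] by (simp add: sum.inter_restrict[symmetric] Int_absorb1)
    finally show "(\<Sum>j=1..Nr. alg_fraction out i j * (D j (alg_bid out i j) * alg_bid out i j
        - integral {0..alg_bid out i j} (D j))) = \<dots>" .
  qed
  also have "\<dots> = (\<Sum>c\<in>out. sum I (campaigns c) * bid c
      - (\<Sum>j\<in>targets c. integral {0..bid c} (D j)))"
    using cleared_cost out_cleared out_subset by (intro sum.cong) auto
  finally show ?thesis .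
qed

text \<open>Distinct components have distinct bids, so the sum over components can be reindexed by
  bid values.\<close>

lemma alg_cost_bid_values:
  "opt_cost Nc Nr D (alg_bid out, alg_fraction out) =
    (\<Sum>p\<in>bid_values out.
         (\<Sum>i\<in>campaigns (component_at out p). I i) * p
         - integral {0..p} (\<lambda>b. \<Sum>j\<in>targets (component_at out p). D j b))"
proof -
  have "inj_on bid out" using out_separated by (intro inj_onI) blast
  then have "(\<Sum>p\<in>bid_values out.
         (\<Sum>i\<in>campaigns (component_at out p). I i) * p
         - integral {0..p} (\<lambda>b. \<Sum>j\<in>targets (component_at out p). D j b)) =
      (\<Sum>c\<in>out. sum I (campaigns c) * bid c - integral {0..bid c} (\<lambda>b. \<Sum>j\<in>targets c. D j b))"
    unfolding bid_values_def by (simp add: sum.reindex component_at_eq)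
  also have "\<dots> = (\<Sum>c\<in>out. sum I (campaigns c) * bid c
      - (\<Sum>j\<in>targets c. integral {0..bid c} (D j)))"
  proof (intro sum.cong refl arg_cong2[of _ _ _ _ "(-)"] integral_sum)
    fix c assume c: "c \<in> out"
    show "finite (targets c)" using out_subset(2)[OF c] finite_subset by blast
    show "D j integrable_on {0..bid c}" if "j \<in> targets c" for j
      using out_subset(2)[OF c] that by (intro D_integrable) auto
  qed
  finally show ?thesis using alg_cost by simp
qed

text \<open>The dual values are the bids of the components containing the campaign and the group.
  Since a campaign reaches only groups whose component bids at least as much,
  \<open>weak_duality\<close> applies, and its bound regrouped by components is the cost in
  \<open>alg_cost\<close>.\<close>

lemma alg_cost_le:
  assumes feas: "opt_feasible Nc Nr I A D (b, \<gamma>)"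
  shows "opt_cost Nc Nr D (alg_bid out, alg_fraction out) \<le> opt_cost Nc Nr D (b, \<gamma>)"
proof -
  have "\<forall>j\<in>{1..Nr}. \<exists>c. c \<in> out \<and> j \<in> targets c" using out_Union by blast
  then obtain C where C: "\<And>j. j \<in> {1..Nr} \<Longrightarrow> C j \<in> out \<and> j \<in> targets (C j)"
    by metis
  have C_eq: "C j = c" if "c \<in> out" "j \<in> targets c" for c j
    using out_separated[OF that(1), of "C j"] C[of j] out_subset(2) that by blast
  define l where "l i = bid (component_of out i)" for i
  define m where "m j = bid (C j)" for j
  have "(\<Sum>i=1..Nc. I i * l i) - (\<Sum>j=1..Nr. integral {0..m j} (D j)) \<le> opt_cost Nc Nr D (b, \<gamma>)"
  proof (rule weak_duality[OF feas])
    fix i assume i: "i \<in> {1..Nc}"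
    note c = component_of_mem[OF i]
    show "0 \<le> l i" using c bid_nonneg by (simp add: l_def)
    fix j assume j: "j \<in> A i"
    then have "j \<in> {1..Nr}" using A_subset i by blast
    then show "l i \<le> m j"
      using out_separated[of "component_of out i" "C j"] c C[of j] j by (auto simp: l_def m_def)
  qed
  moreover have "(\<Sum>i=1..Nc. I i * l i) = (\<Sum>c\<in>out. sum I (campaigns c) * bid c)"
    unfolding sum_campaigns using component_of_eq
    by (intro sum.cong) (auto simp: l_def sum_distrib_right)
  moreover have "(\<Sum>j=1..Nr. integral {0..m j} (D j)) =
      (\<Sum>c\<in>out. \<Sum>j\<in>targets c. integral {0..bid c} (D j))"
    unfolding sum_targets using C_eq by (intro sum.cong) (auto simp: m_def)
  ultimately show ?thesis by (simp add: alg_cost sum_subtractf)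
qed

end

end

theorem proposition6:
  fixes Nc Nr :: nat and I :: "nat \<Rightarrow> real" and A :: "nat \<Rightarrow> nat set"
    and D :: "nat \<Rightarrow> real \<Rightarrow> real" and out :: "component set"
  assumes "\<And>i. i \<in> {1..Nc} \<Longrightarrow> 0 \<le> I i"
    and "\<And>i. i \<in> {1..Nc} \<Longrightarrow> A i \<subseteq> {1..Nr}"
    and "\<And>j. j \<in> {1..Nr} \<Longrightarrow> bidders Nc A j \<noteq> {}"
    and "\<And>j x. j \<in> {1..Nr} \<Longrightarrow> 0 \<le> x \<Longrightarrow> 0 \<le> D j x"
    and "\<And>j. j \<in> {1..Nr} \<Longrightarrow> mono_on {0..} (D j)"
    and "\<And>j x. j \<in> {1..Nr} \<Longrightarrow> 0 \<le> x \<Longrightarrow> continuous (at_right x) (D j)"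
    and "\<exists>b \<gamma>. opt_feasible Nc Nr I A D (b, \<gamma>)"
    and "rec_run Nc I A D {1..Nc} {1..Nr} out"
    and "\<And>j. j \<in> {1..Nr} \<Longrightarrow> continuous_on {0..} (D j)"
  shows "is_arg_min (opt_cost Nc Nr D) (opt_feasible Nc Nr I A D) (alg_bid out, alg_fraction out) \<and>
    opt_cost Nc Nr D (alg_bid out, alg_fraction out) =
      (\<Sum>p\<in>bid_values out.
         (\<Sum>i\<in>campaigns (component_at out p). I i) * p
         - integral {0..p} (\<lambda>b. \<Sum>j\<in>targets (component_at out p). D j b))"
proof -
  interpret market Nc Nr I A D
    using assms by unfold_locales auto
  \<comment> \<open>Every group has a bidder, so the covering invariant holds at the outermost
    call.\<close>
  have biddable: "{1..Nr} \<subseteq> \<Union>(A ` {1..Nc})"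
    using assms(3) by (fastforce simp: bidders_def)
  show ?thesis
    using alg_feasible[OF assms(8) biddable] alg_cost_le[OF assms(8) biddable]
      alg_cost_bid_values[OF assms(8) biddable]
    unfolding is_arg_min_def by (auto simp: not_less)
qed

end
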